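(* Let $(\boldsymbol{x}_1,y_1),\dots,(\boldsymbol{x}_n,y_n),(\boldsymbol{x}_{n+1},y_{n+1})$ be exchangeable random elements of $\mathcal{X}\times\mathcal{Y}$, let $s:\mathcal{X}\times\mathcal{Y}\to\mathbb{R}$ be a score function, let $\alpha\in(0,1)$, and let $q_\alpha=\mathrm{Quant}\left(\alpha;\{s(\boldsymbol{x}_i,y_i)\}_{i=1}^n\right)$ be the $\alpha$-quantile of the clean calibration scores. Let $\mathcal{B}$ be a threat model, and let $\overline{s}:\mathcal{X}\times\mathcal{Y}\to\mathbb{R}$ be such that $\overline{s}(\boldsymbol{x}',y)\ge s(\boldsymbol{z},y)$ for all $\boldsymbol{x}'\in\mathcal{X}$, $y\in\mathcal{Y}$ and all $\boldsymbol{z}\in\mathcal{B}^{-1}(\boldsymbol{x}')$. Define $\overline{\mathcal{C}}_\alpha(\boldsymbol{x})=\{y\in\mathcal{Y}:\overline{s}(\boldsymbol{x},y)\ge q_\alpha\}$. Then for every (possibly random, adversarially chosen) $\tilde{\boldsymbol{x}}_{n+1}$ with $\tilde{\boldsymbol{x}}_{n+1}\in\mathcal{B}(\boldsymbol{x}_{n+1})$, $$\Pr\left[y_{n+1}\in\overline{\mathcal{C}}_\alpha(\tilde{\boldsymbol{x}}_{n+1})\right]\ge 1-\alpha.$$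
   Context: $\mathcal{X}$ is the input space and $\mathcal{Y}$ is a finite label set. All functions and random elements are assumed measurable as needed. Quantile convention: for a finite family $A$ of $n$ real numbers and $\tau\in(0,1)$, $\mathrm{Quant}(\tau;A)$ is the $\lfloor\tau(n+1)\rfloor$-th smallest element of $A$ (counted with multiplicity), and $-\infty$ if $\lfloor\tau(n+1)\rfloor=0$. Threat model: a map $\mathcal{B}$ assigning to each clean input $\boldsymbol{x}\in\mathcal{X}$ the set $\mathcal{B}(\boldsymbol{x})\subseteq\mathcal{X}$ of allowed perturbed inputs. Its reversal is $\mathcal{B}^{-1}(\boldsymbol{x}')=\{\boldsymbol{z}\in\mathcal{X}:\boldsymbol{x}'\in\mathcal{B}(\boldsymbol{z})\}$, the set of clean inputs from which $\boldsymbol{x}'$ may have been obtained. Examples: the ball $\mathcal{B}_r(\boldsymbol{x})=\{\tilde{\boldsymbol{x}}:\|\tilde{\boldsymbol{x}}-\boldsymbol{x}\|_2\le r\}$, for which $\mathcal{B}_r^{-1}=\mathcal{B}_r$; and for binary vectors the set $\mathcal{B}_{r_a,r_d}(\boldsymbol{x})$ of vectors obtained from $\boldsymbol{x}$ by flipping at most $r_a$ zeros to ones and at most $r_d$ ones to zeros, for which $\mathcal{B}_{r_a,r_d}^{-1}=\mathcal{B}_{r_d,r_a}$. *)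

theory Defs
  imports
    "HOL-Probability.Probability"
    "HOL-Combinatorics.Permutations"
    "HOL-Library.Multiset"
begin

text \<open>
  Exchangeability of a finite family of random elements of \<open>N\<close>: its joint law, a measure on the
  product space over \<open>I\<close>, is invariant under every permutation of the index set.
\<close>

definition exchangeable :: "'w measure \<Rightarrow> 'i set \<Rightarrow> 'b measure \<Rightarrow> ('i \<Rightarrow> 'w \<Rightarrow> 'b) \<Rightarrow> bool" where
  "exchangeable M I N Z \<longleftrightarrow>
     finite I \<and> (\<forall>i\<in>I. Z i \<in> measurable M N) \<and>
     (\<forall>\<pi>. \<pi> permutes I \<longrightarrow>
        distr M (PiM I (\<lambda>_. N)) (\<lambda>\<omega>. \<lambda>i\<in>I. Z (\<pi> i) \<omega>) =
        distr M (PiM I (\<lambda>_. N)) (\<lambda>\<omega>. \<lambda>i\<in>I. Z i \<omega>))"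

text \<open>
  A finite family of reals, counted with multiplicity, is a multiset. List indices start at 0, so
  the \<open>k\<close>-th smallest element is at position \<open>k - 1\<close>; for \<open>0 < \<tau> < 1\<close> the rank \<open>k\<close> is at most
  \<open>size A\<close>, so the lookup is within bounds.
\<close>

definition Quant :: "real \<Rightarrow> real multiset \<Rightarrow> ereal" where
  "Quant \<tau> A =
     (let k = nat \<lfloor>\<tau> * (real (size A) + 1)\<rfloor>
      in if k = 0 then -\<infinity> else ereal (sorted_list_of_multiset A ! (k - 1)))"

definition reversal :: "'x set \<Rightarrow> ('x \<Rightarrow> 'x set) \<Rightarrow> 'x \<Rightarrow> 'x set" where
  "reversal X B x' = {z \<in> X. x' \<in> B z}"

definition prediction_set :: "'y set \<Rightarrow> ('x \<times> 'y \<Rightarrow> real) \<Rightarrow> ereal \<Rightarrow> 'x \<Rightarrow> 'y set" where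
  "prediction_set Y s q x = {y \<in> Y. ereal (s (x, y)) \<ge> q}"

end

theory Submission
  imports Defs
begin

text \<open>
  The true label is excluded only if the clean test score has rank at most
  \<open>k = \<lfloor>\<alpha> (n + 1)\<rfloor>\<close> among all \<open>n + 1\<close> clean scores, ranks being counted with \<open>\<le>\<close>: the score
  bound dominates the clean score at the true input, which lies in the reversal of the threat model.
  At most \<open>k\<close> indices can have rank at most \<open>k\<close>, and by exchangeability each index has
  the same probability of this, so that probability is at most \<open>k / (n + 1) \<le> \<alpha>\<close>.
\<close>

text \<open>In a sorted list the entries \<le> \<open>t\<close> form a prefix, so position
  \<open>m\<close> carries such an entry exactly when that prefix is longer than
  \<open>m\<close>.\<close>

lemma sorted_nth_le_iff:
  assumes "sorted xs" and "m < length xs"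
  shows "xs ! m \<le> t \<longleftrightarrow> m < length (filter (\<lambda>a. a \<le> t) xs)"
  using assms
proof (induction xs arbitrary: m)
  case (Cons a xs)
  show ?case
  proof (cases "a \<le> t")
    case True
    then show ?thesis using Cons by (cases m) auto
  next
    case False
    then have "b > t" if "b \<in> set (a # xs)" for b
      using Cons.prems(1) that by auto
    then have "(a # xs) ! m > t" and "filter (\<lambda>a. a \<le> t) (a # xs) = []"
      using nth_mem[OF Cons.prems(2)] by (blast, force simp: filter_empty_conv)
    then show ?thesis by simp
  qed
qed simp

text \<open>Trades the sorted list for a count, a form in which measurability and invariance under
  permutations are easy to see.\<close>

lemma Quant_le_ereal_iff:
  assumes "0 < \<tau>" and "\<tau> < 1"
  shows "Quant \<tau> A \<le> ereal t \<longleftrightarrow>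
    nat \<lfloor>\<tau> * (real (size A) + 1)\<rfloor> \<le> size (filter_mset (\<lambda>a. a \<le> t) A)"
proof -
  define k where "k = nat \<lfloor>\<tau> * (real (size A) + 1)\<rfloor>"
  let ?xs = "sorted_list_of_multiset A"
  have len: "length ?xs = size A"
    by (metis mset_sorted_list_of_multiset size_mset)
  \<comment> \<open>As \<tau> < 1, the floor stays below \<open>size A + 1\<close>, so the lookup is
    within bounds.\<close>
  have "\<tau> * (real (size A) + 1) < real (size A) + 1"
    using assms by simp
  then have k: "k \<le> size A"
    unfolding k_def by linarith
  have "length (filter (\<lambda>a. a \<le> t) ?xs) = size (filter_mset (\<lambda>a. a \<le> t) A)"
    by (metis mset_filter mset_sorted_list_of_multiset size_mset)
  \<comment> \<open>For \<open>k > 0\<close> the condition \<open>k - 1 < c\<close> is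
    \<open>k \<le> c\<close>; for \<open>k = 0\<close> the quantile is -\<infinity> and both sides
    of the claim are true.\<close>
  moreover have "?xs ! (k - 1) \<le> t \<longleftrightarrow> k - 1 < length (filter (\<lambda>a. a \<le> t) ?xs)" if "k > 0"
    using that k len by (intro sorted_nth_le_iff) auto
  ultimately show ?thesis
    unfolding Quant_def Let_def k_def[symmetric] by auto
qed

lemma Quant_image_mset_le_iff:
  assumes "0 < \<tau>" and "\<tau> < 1" and "finite I"
  shows "Quant \<tau> {# f i. i \<in># mset_set I #} \<le> ereal t \<longleftrightarrow>
    nat \<lfloor>\<tau> * (real (card I) + 1)\<rfloor> \<le> card {i \<in> I. f i \<le> t}"
  using assms
  by (simp add: Quant_le_ereal_iff filter_mset_image_mset)

text \<open>Among the indices of rank at most \<open>k\<close>, take one with the largest value: its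
  rank counts all of them, ties included.\<close>

lemma card_rank_le:
  fixes f :: "'i \<Rightarrow> 'a :: linorder"
  assumes "finite I"
  shows "card {j \<in> I. card {i \<in> I. f i \<le> f j} \<le> k} \<le> k"
proof (cases "{j \<in> I. card {i \<in> I. f i \<le> f j} \<le> k} = {}")
  case False
  let ?J = "{j \<in> I. card {i \<in> I. f i \<le> f j} \<le> k}"
  have fin: "finite ?J" using assms by simp
  then have "Max (f ` ?J) \<in> f ` ?J"
    using False by (intro Max_in) auto
  then obtain j where j: "j \<in> ?J" "f j = Max (f ` ?J)"
    by auto
  have "?J \<subseteq> {i \<in> I. f i \<le> f j}"
    unfolding j(2) using fin by (auto intro!: Max_ge)
  then have "card ?J \<le> card {i \<in> I. f i \<le> f j}"
    using assms by (intro card_mono) auto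
  also have "\<dots> \<le> k" using j(1) by simp
  finally show ?thesis .
next
  case True
  then show ?thesis by (metis card.empty le0)
qed

text \<open>The cardinality is a finite sum of indicators of measurable comparisons.\<close>

lemma measurable_card_le:
  fixes f :: "'i \<Rightarrow> 'w \<Rightarrow> real"
  assumes "finite I" and f: "\<And>i. i \<in> I \<Longrightarrow> f i \<in> borel_measurable M"
    and [measurable]: "g \<in> borel_measurable M"
  shows "(\<lambda>\<omega>. card {i \<in> I. f i \<omega> \<le> g \<omega>}) \<in> measurable M (count_space UNIV)"
proof -
  have "(\<lambda>\<omega>. \<Sum>i\<in>I. if f i \<omega> \<le> g \<omega> then 1 else 0 :: nat) \<in> measurable M (count_space UNIV)"
  proof (rule measurable_sum_nat)
    fix i assume "i \<in> I"
    note [measurable] = f[OF this]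
    show "(\<lambda>\<omega>. if f i \<omega> \<le> g \<omega> then 1 else 0 :: nat) \<in> measurable M (count_space UNIV)"
      by measurable
  qed
  moreover have "(\<Sum>i\<in>I. if f i \<omega> \<le> g \<omega> then 1 else 0) = card {i \<in> I. f i \<omega> \<le> g \<omega>}" for \<omega>
    using \<open>finite I\<close> by (simp add: sum.If_cases Int_def)
  ultimately show ?thesis by simp
qed

text \<open>Swapping \<open>j\<close> and \<open>l\<close> preserves the joint law. It turns the
  event for \<open>l\<close> into the one for \<open>j\<close>, because a rank depends on the other
  scores only through a count over all of \<open>I\<close>.\<close>

lemma exchangeable_rank_prob_eq:
  fixes s :: "'b \<Rightarrow> real"
  assumes exch: "exchangeable M I N Z" and s [measurable]: "s \<in> borel_measurable N"
    and j: "j \<in> I" and l: "l \<in> I"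
  shows "measure M {\<omega> \<in> space M. card {i \<in> I. s (Z i \<omega>) \<le> s (Z j \<omega>)} \<le> k} =
         measure M {\<omega> \<in> space M. card {i \<in> I. s (Z i \<omega>) \<le> s (Z l \<omega>)} \<le> k}"
proof -
  let ?P = "PiM I (\<lambda>_. N)"
  let ?A = "{z \<in> space ?P. card {i \<in> I. s (z i) \<le> s (z l)} \<le> k}"
  define \<pi> where "\<pi> = Transposition.transpose j l"
  have fin: "finite I" and Z: "\<And>i. i \<in> I \<Longrightarrow> Z i \<in> measurable M N"
    using exch by (auto simp: exchangeable_def)
  have \<pi>: "\<pi> permutes I"
    unfolding \<pi>_def using j l by (rule permutes_swap_id)
  have \<pi>I: "\<pi> i \<in> I" if "i \<in> I" for i
    using that permutes_in_image[OF \<pi>] by simp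
  have A: "?A \<in> sets ?P"
  proof -
    have "(\<lambda>z. card {i \<in> I. s (z i) \<le> s (z l)}) \<in> measurable ?P (count_space UNIV)"
      using fin l by (intro measurable_card_le) measurable
    then show ?thesis by measurable
  qed
  \<comment> \<open>Kept general in \<open>p\<close> to serve both sides of the exchangeability
    equation: \<open>p\<close> is the swap on one side and the identity on the other.\<close>
  have pull: "measure (distr M ?P (\<lambda>\<omega>. \<lambda>i\<in>I. Z (p i) \<omega>)) ?A =
      measure M {\<omega> \<in> space M. card {i \<in> I. s (Z (p i) \<omega>) \<le> s (Z (p l) \<omega>)} \<le> k}"
    if p: "\<And>i. i \<in> I \<Longrightarrow> p i \<in> I" for p
  proof -
    have m: "(\<lambda>\<omega>. \<lambda>i\<in>I. Z (p i) \<omega>) \<in> measurable M ?P"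
      using Z p by (intro measurable_restrict) auto
    have "(\<lambda>\<omega>. \<lambda>i\<in>I. Z (p i) \<omega>) -` ?A \<inter> space M =
        {\<omega> \<in> space M. card {i \<in> I. s (Z (p i) \<omega>) \<le> s (Z (p l) \<omega>)} \<le> k}"
      using measurable_space[OF m] l by (auto cong: conj_cong)
    then show ?thesis
      using measure_distr[OF m A] by simp
  qed
  \<comment> \<open>The swap merely relabels the counted indices; being its own inverse, it is also
    the witness for bijectivity.\<close>
  have rank: "card {i \<in> I. s (Z (\<pi> i) \<omega>) \<le> s (Z j \<omega>)} = card {i \<in> I. s (Z i \<omega>) \<le> s (Z j \<omega>)}" for \<omega>
  proof (rule bij_betw_same_card[of \<pi>])
    show "bij_betw \<pi> {i \<in> I. s (Z (\<pi> i) \<omega>) \<le> s (Z j \<omega>)} {i \<in> I. s (Z i \<omega>) \<le> s (Z j \<omega>)}"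
      by (rule bij_betw_byWitness[where f' = \<pi>]) (auto simp: \<pi>I, auto simp: \<pi>_def)
  qed
  have "distr M ?P (\<lambda>\<omega>. \<lambda>i\<in>I. Z (\<pi> i) \<omega>) = distr M ?P (\<lambda>\<omega>. \<lambda>i\<in>I. Z i \<omega>)"
    using exch \<pi> by (simp add: exchangeable_def)
  then have "measure M {\<omega> \<in> space M. card {i \<in> I. s (Z (\<pi> i) \<omega>) \<le> s (Z (\<pi> l) \<omega>)} \<le> k} =
      measure M {\<omega> \<in> space M. card {i \<in> I. s (Z i \<omega>) \<le> s (Z l \<omega>)} \<le> k}"
    using pull[of \<pi>] pull[of "\<lambda>i. i"] \<pi>I by simp
  moreover have "\<pi> l = j" by (simp add: \<pi>_def)
  ultimately show ?thesis by (simp add: rank)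
qed

text \<open>Double counting: the left side sums equal probabilities over \<open>I\<close>, hence is
  the expected number of indices of rank at most \<open>k\<close>, and \<open>card_rank_le\<close>
  bounds that number pointwise.\<close>

lemma exchangeable_rank_prob_le:
  fixes s :: "'b \<Rightarrow> real"
  assumes "prob_space M" and exch: "exchangeable M I N Z"
    and s [measurable]: "s \<in> borel_measurable N" and l: "l \<in> I"
  shows "real (card I) *
    measure M {\<omega> \<in> space M. card {i \<in> I. s (Z i \<omega>) \<le> s (Z l \<omega>)} \<le> k} \<le> real k"
proof -
  interpret prob_space M by fact
  let ?R = "\<lambda>j. {\<omega> \<in> space M. card {i \<in> I. s (Z i \<omega>) \<le> s (Z j \<omega>)} \<le> k}"
  have fin: "finite I" and Z: "\<And>i. i \<in> I \<Longrightarrow> Z i \<in> measurable M N"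
    using exch by (auto simp: exchangeable_def)
  have sZ: "(\<lambda>\<omega>. s (Z i \<omega>)) \<in> borel_measurable M" if "i \<in> I" for i
    using measurable_compose[OF Z[OF that] s] .
  have R: "?R j \<in> events" if "j \<in> I" for j
  proof -
    have "(\<lambda>\<omega>. card {i \<in> I. s (Z i \<omega>) \<le> s (Z j \<omega>)}) \<in> measurable M (count_space UNIV)"
      using fin sZ that by (intro measurable_card_le) auto
    then show ?thesis by measurable
  qed
  have "real (card I) * prob (?R l) = (\<Sum>j\<in>I. prob (?R j))"
    using exchangeable_rank_prob_eq[OF exch s _ l] by simp
  also have "\<dots> = expectation (\<lambda>\<omega>. \<Sum>j\<in>I. indicator (?R j) \<omega>)"
    using R by (subst Bochner_Integration.integral_sum)
      (auto simp: emeasure_eq_measure intro!: integrable_real_indicator)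
  also have "\<dots> \<le> expectation (\<lambda>_. real k)"
  proof (rule integral_mono)
    show "integrable M (\<lambda>\<omega>. \<Sum>j\<in>I. indicator (?R j) \<omega> :: real)"
      using R by (intro Bochner_Integration.integrable_sum integrable_real_indicator)
        (auto simp: emeasure_eq_measure)
  next
    fix \<omega> assume \<omega>: "\<omega> \<in> space M"
    have "(\<Sum>j\<in>I. indicator (?R j) \<omega> :: real) =
        real (card {j \<in> I. card {i \<in> I. s (Z i \<omega>) \<le> s (Z j \<omega>)} \<le> k})"
      using fin \<omega> by (simp add: indicator_def sum.If_cases Int_def)
    then show "(\<Sum>j\<in>I. indicator (?R j) \<omega>) \<le> real k"
      using card_rank_le[OF fin, of "\<lambda>i. s (Z i \<omega>)" k] by simp
  qed simp
  also have "\<dots> = real k" by (simp add: prob_space)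
  finally show ?thesis .
qed

theorem proposition3p1:
  fixes M :: "'w measure" and X :: "'x measure" and Y :: "'y set" and n :: nat
    and x :: "nat \<Rightarrow> 'w \<Rightarrow> 'x" and y :: "nat \<Rightarrow> 'w \<Rightarrow> 'y"
    and s s_bar :: "'x \<times> 'y \<Rightarrow> real" and \<alpha> :: real
    and B :: "'x \<Rightarrow> 'x set" and x_tilde :: "'w \<Rightarrow> 'x"
  assumes "prob_space M"
    and "finite Y"
    and "exchangeable M {1..n+1} (X \<Otimes>\<^sub>M count_space Y) (\<lambda>i \<omega>. (x i \<omega>, y i \<omega>))"
    and "s \<in> borel_measurable (X \<Otimes>\<^sub>M count_space Y)"
    and "0 < \<alpha>" and "\<alpha> < 1"
    and "\<And>z. z \<in> space X \<Longrightarrow> B z \<subseteq> space X"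
    and "s_bar \<in> borel_measurable (X \<Otimes>\<^sub>M count_space Y)"
    and "\<And>x' l z. \<lbrakk>x' \<in> space X; l \<in> Y; z \<in> reversal (space X) B x'\<rbrakk> \<Longrightarrow> s_bar (x', l) \<ge> s (z, l)"
    and "x_tilde \<in> measurable M X"
    and "AE \<omega> in M. x_tilde \<omega> \<in> B (x (n+1) \<omega>)"
  shows "measure M {\<omega> \<in> space M.
           y (n+1) \<omega> \<in> prediction_set Y s_bar
             (Quant \<alpha> {# s (x i \<omega>, y i \<omega>). i \<in># mset_set {1..n} #}) (x_tilde \<omega>)} \<ge> 1 - \<alpha>"
proof -
  interpret prob_space M by fact
  note exch = assms(3) and s [measurable] = assms(4) and s_bar [measurable] = assms(8)
    and x_tilde [measurable] = assms(10)
  define k where "k = nat \<lfloor>\<alpha> * (real n + 1)\<rfloor>"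
  define S where "S i \<omega> = s (x i \<omega>, y i \<omega>)" for i \<omega>
  define T where "T \<omega> = s_bar (x_tilde \<omega>, y (n+1) \<omega>)" for \<omega>
  have Z: "(\<lambda>\<omega>. (x i \<omega>, y i \<omega>)) \<in> measurable M (X \<Otimes>\<^sub>M count_space Y)" if "i \<in> {1..n+1}" for i
    using exch that by (auto simp: exchangeable_def)
  have S: "S i \<in> borel_measurable M" if "i \<in> {1..n+1}" for i
    unfolding S_def using measurable_compose[OF Z[OF that] s] .
  have y [measurable]: "y (n+1) \<in> measurable M (count_space Y)"
    using measurable_compose[OF Z[of "n+1"] measurable_snd] by simp
  have T: "T \<in> borel_measurable M"
    unfolding T_def by measurable
  \<comment> \<open>\<open>?E\<close> is coverage in counting form, over the \<open>n\<close>
    calibration scores; \<open>?F\<close> is the event of low clean rank, over all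
    \<open>n + 1\<close> scores.\<close>
  let ?E = "{\<omega> \<in> space M. k \<le> card {i \<in> {1..n}. S i \<omega> \<le> T \<omega>}}"
  let ?F = "{\<omega> \<in> space M. card {i \<in> {1..n+1}. S i \<omega> \<le> S (n+1) \<omega>} \<le> k}"
  have E: "?E \<in> events"
  proof -
    have "(\<lambda>\<omega>. card {i \<in> {1..n}. S i \<omega> \<le> T \<omega>}) \<in> measurable M (count_space UNIV)"
      using S T by (intro measurable_card_le) auto
    then show ?thesis by measurable
  qed
  have F: "?F \<in> events"
  proof -
    have "(\<lambda>\<omega>. card {i \<in> {1..n+1}. S i \<omega> \<le> S (n+1) \<omega>}) \<in> measurable M (count_space UNIV)"
      using S by (intro measurable_card_le) auto
    then show ?thesis by measurable
  qed
  \<comment> \<open>Only almost sure, since the perturbation respects the threat model only almost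
    surely.\<close>
  have "AE \<omega> in M. \<omega> \<in> space M - ?F \<longrightarrow> \<omega> \<in> ?E"
    using assms(11) AE_space
  proof eventually_elim
    case (elim \<omega>)
    have "x (n+1) \<omega> \<in> space X" and yY: "y (n+1) \<omega> \<in> Y"
      using measurable_space[OF Z[of "n+1"] elim(2)] by (auto simp: space_pair_measure)
    then have "x (n+1) \<omega> \<in> reversal (space X) B (x_tilde \<omega>)"
      using elim(1) by (simp add: reversal_def)
    then have ST: "S (n+1) \<omega> \<le> T \<omega>"
      unfolding S_def T_def
      using assms(9) yY measurable_space[OF x_tilde elim(2)] by blast
    \<comment> \<open>The test score counts itself, so off \<open>?F\<close>, where the rank is at
      least \<open>k + 1\<close>, at least \<open>k\<close> calibration scores lie below it and
      hence below \<open>T\<close>.\<close>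
    have "{i \<in> {1..n+1}. S i \<omega> \<le> S (n+1) \<omega>} = insert (n+1) {i \<in> {1..n}. S i \<omega> \<le> S (n+1) \<omega>}"
      by auto
    then have "card {i \<in> {1..n+1}. S i \<omega> \<le> S (n+1) \<omega>} = Suc (card {i \<in> {1..n}. S i \<omega> \<le> S (n+1) \<omega>})"
      by simp
    moreover have "card {i \<in> {1..n}. S i \<omega> \<le> S (n+1) \<omega>} \<le> card {i \<in> {1..n}. S i \<omega> \<le> T \<omega>}"
      using ST by (intro card_mono) auto
    ultimately show ?case by auto
  qed
  then have "prob (space M - ?F) \<le> prob ?E"
    using E by (rule finite_measure_mono_AE)
  moreover have "real (n+1) * prob ?F \<le> real k"
    using exchangeable_rank_prob_le[OF \<open>prob_space M\<close> exch s, of "n+1" k] by (simp add: S_def)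
  moreover have "real k \<le> real (n+1) * \<alpha>"
  proof -
    \<comment> \<open>Nonnegativity ensures that \<open>nat\<close> does not truncate; the floor
      then only rounds down.\<close>
    have "0 \<le> \<alpha> * (real n + 1)" using assms(5) by simp
    then have "real k \<le> \<alpha> * (real n + 1)" unfolding k_def by linarith
    then show ?thesis by (simp add: algebra_simps)
  qed
  ultimately have "prob (space M - ?F) \<le> prob ?E" and "real (n+1) * prob ?F \<le> real (n+1) * \<alpha>"
    by (blast, linarith)
  then have "1 - \<alpha> \<le> prob ?E"
    unfolding prob_compl[OF F] by (subst (asm) mult_le_cancel_left_pos) linarith+
  \<comment> \<open>The label lies in \<open>Y\<close> on all of \<open>space M\<close>, so
    membership reduces to the quantile inequality, at every outcome.\<close>
  moreover have "{\<omega> \<in> space M. y (n+1) \<omega> \<in> prediction_set Y s_bar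
      (Quant \<alpha> {# s (x i \<omega>, y i \<omega>). i \<in># mset_set {1..n} #}) (x_tilde \<omega>)} = ?E"
    using measurable_space[OF y] Quant_image_mset_le_iff[OF assms(5,6), of "{1..n}"]
    by (auto simp: prediction_set_def S_def T_def k_def)
  ultimately show ?thesis by simp
qed

end
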